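(* Let $n\ge 1$ be an integer and suppose that \[ B(\zeta)=\sigma\prod_{k=1}^n\frac{\zeta-z_k}{1-\overline{z_k}\zeta}, \] where $z_1,z_2,\dots,z_n\in\mathbb{D}$ and $\sigma\in\mathbb{T}$. If \[ \sum_{k=1}^n\frac{1+|z_k|}{1-|z_k|}\le n+1, \qquad ( * ) \] then $\zeta\mapsto \zeta^{n+1}/B(\zeta)$ is a circle homeomorphism. In particular, this holds if $|z_k|\le\frac{1}{2n+1}$ for all $k$. If all numbers $z_k$ have the same argument, then condition $( * )$ is also necessary for $\zeta^{n+1}/B(\zeta)$ to be a circle homeomorphism.
   Context: $\mathbb{T}=\{z\in\mathbb{C}\colon |z|=1\}$ and $\mathbb{D}=\{z\in\mathbb{C}\colon |z|<1\}$. A circle homeomorphism is a homeomorphism of $\mathbb{T}$ onto itself; throughout, circle homeomorphisms are assumed sense-preserving. The function $\zeta^{n+1}/B(\zeta)$ is regarded as a function of $\zeta\in\mathbb{T}$. "All $z_k$ have the same argument" means that there is $\omega\in\mathbb{T}$ with $z_k=|z_k|\omega$ for every $k$. *)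

theory Defs
  imports "HOL-Analysis.Analysis"
begin

definition finite_blaschke :: "complex \<Rightarrow> nat \<Rightarrow> (nat \<Rightarrow> complex) \<Rightarrow> complex \<Rightarrow> complex" where
  "finite_blaschke \<sigma> n z \<zeta> = \<sigma> * (\<Prod>k=1..n. (\<zeta> - z k) / (1 - cnj (z k) * \<zeta>))"

(* A circle map preserves sense if it lifts, along t \<mapsto> exp (i t), to a continuous
   increasing map of the real line. Only the values of f on the unit circle matter. *)
definition sense_preserving_on_circle :: "(complex \<Rightarrow> complex) \<Rightarrow> bool" where
  "sense_preserving_on_circle f \<longleftrightarrow>
     (\<exists>\<phi>::real \<Rightarrow> real. continuous_on UNIV \<phi> \<and> strict_mono \<phi> \<and> (\<forall>t. f (cis t) = cis (\<phi> t)))"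

definition circle_homeomorphism :: "(complex \<Rightarrow> complex) \<Rightarrow> bool" where
  "circle_homeomorphism f \<longleftrightarrow>
     (\<exists>g. homeomorphism (sphere 0 1) (sphere 0 1) f g) \<and> sense_preserving_on_circle f"

end

theory Submission
  imports Defs "HOL-Library.Real_Mod"
begin

text \<open>
  On the unit circle each Blaschke factor is \<open>\<zeta> * cnj w / w\<close> with
  \<open>w = 1 - cnj z\<^sub>k * \<zeta>\<close> in the right half plane. Hence \<open>\<zeta> ^ (n + 1) / B \<zeta>\<close> has the
  explicit lift \<open>t - Arg \<sigma> + 2 * (\<Sum>k. Im (Ln w\<^sub>k))\<close>, whose derivative is \<open>n + 1\<close> minus the sum of
  the Poisson kernels of the \<open>z\<^sub>k\<close>. The Poisson kernel of \<open>z\<^sub>k\<close> is at most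
  \<open>(1 + \<bar>z\<^sub>k\<bar>) / (1 - \<bar>z\<^sub>k\<bar>)\<close>, with equality for \<open>z\<^sub>k \<noteq> 0\<close> only in the direction of \<open>z\<^sub>k\<close>.
  So the condition makes the derivative nonnegative with isolated zeros; and if all \<open>z\<^sub>k\<close> point in
  the same direction, the bound is attained simultaneously, so a larger sum gives a negative
  derivative there.
\<close>

section \<open>Circle maps and their lifts to the real line\<close>

lemma cis_sum: "cis (sum f A) = (\<Prod>x\<in>A. cis (f x))"
  by (induction A rule: infinite_finite_induct) (auto simp: cis_mult[symmetric])

text \<open>The shift identity gives the lift degree one. By strict monotonicity a half-open period
  goes into a half-open interval of length \<open>2 * pi\<close>, whence injectivity; the
  intermediate value theorem gives surjectivity, and compactness of the circle makes the inverse
  continuous.\<close>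

lemma circle_homeomorphism_of_lift:
  assumes cf: "continuous_on (sphere 0 1) f"
    and c\<phi>: "continuous_on UNIV \<phi>" and mono: "strict_mono \<phi>"
    and shift: "\<And>t. \<phi> (t + 2 * pi) = \<phi> t + 2 * pi"
    and lift: "\<And>t. f (cis t) = cis (\<phi> t)"
  shows "circle_homeomorphism f"
proof -
  have inj: "inj_on f (sphere 0 1)"
  proof (rule inj_onI)
    fix x y :: complex
    assume xy: "x \<in> sphere 0 1" "y \<in> sphere 0 1" and eq: "f x = f y"
    have inj': "s = t" if st: "0 \<le> s" "s < 2 * pi" "0 \<le> t" "t < 2 * pi" "s \<le> t"
      and "cis (\<phi> s) = cis (\<phi> t)" for s t
    proof (rule ccontr)
      assume "s \<noteq> t"
      then have "\<phi> s < \<phi> t" "\<phi> t < \<phi> s + 2 * pi"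
        using st strict_monoD[OF mono, of s t] strict_monoD[OF mono, of t "s + 2 * pi"]
        by (auto simp: shift)
      moreover have "cis (\<phi> t - \<phi> s) = 1"
        using that by (simp flip: cis_divide)
      then obtain m :: int where "\<phi> t - \<phi> s = of_int m * (2 * pi)"
        by (auto simp: cis_eq_1_iff)
      ultimately have "0 < of_int m * (2 * pi)" "of_int m * (2 * pi) < 1 * (2 * pi)"
        by linarith+
      then have "0 < (of_int m :: real)" "(of_int m :: real) < 1"
        by (simp add: zero_less_mult_iff, simp only: mult_less_cancel_right) auto
      then show False by simp
    qed
    have arg: "cis (Arg2pi w) = w" if "w \<in> sphere 0 1" for w
      using that Arg2pi_eq[of w] by (simp add: cis_conv_exp)
    have "cis (\<phi> (Arg2pi x)) = cis (\<phi> (Arg2pi y))"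
      using eq arg xy by (simp flip: lift)
    then have "Arg2pi x = Arg2pi y"
      using inj'[of "Arg2pi x" "Arg2pi y"] inj'[of "Arg2pi y" "Arg2pi x"]
      by (metis Arg2pi_ge_0 Arg2pi_lt_2pi linear)
    then show "x = y" using arg xy by metis
  qed
  have surj: "f ` sphere 0 1 = sphere 0 1"
  proof (intro equalityI subsetI)
    fix y assume "y \<in> f ` sphere 0 1"
    then obtain x where "x \<in> sphere 0 1" "y = f x" by auto
    moreover from this have "cis (Arg x) = x"
      using cis_Arg[of x] by (fastforce simp: sgn_div_norm)
    ultimately show "y \<in> sphere 0 1"
      using lift[of "Arg x"] by simp
  next
    fix y :: complex assume y: "y \<in> sphere 0 1"
    \<comment> \<open>\<open>s\<close> is the argument of \<open>y\<close> that lies between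
      \<open>\<phi> 0\<close> and \<open>\<phi> (2 * pi) = \<phi> 0 + 2 * pi\<close>, so the
      intermediate value theorem reaches it.\<close>
    define s where "s = \<phi> 0 + Arg2pi (y / cis (\<phi> 0))"
    have "cis (Arg2pi (y / cis (\<phi> 0))) = y / cis (\<phi> 0)"
      using y Arg2pi_eq[of "y / cis (\<phi> 0)"] by (simp add: cis_conv_exp norm_divide)
    then have s: "cis s = y"
      by (simp add: s_def flip: cis_mult)
    have "\<phi> 0 \<le> s" "s \<le> \<phi> (2 * pi)"
      using shift[of 0] Arg2pi_ge_0[of "y / cis (\<phi> 0)"] Arg2pi_lt_2pi[of "y / cis (\<phi> 0)"]
      by (auto simp: s_def)
    then obtain t where "\<phi> t = s"
      using IVT'[of \<phi> 0 s "2 * pi"] continuous_on_subset[OF c\<phi>] by force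
    then have "y = f (cis t)" using s lift by simp
    then show "y \<in> f ` sphere 0 1" by auto
  qed
  show ?thesis
    unfolding circle_homeomorphism_def sense_preserving_on_circle_def
    using homeomorphism_compact[OF compact_sphere cf surj inj] c\<phi> mono lift by blast
qed

text \<open>The difference is continuous with values in the discrete set of multiples of
  \<open>2 * pi\<close>, hence constant on the connected line. This transfers monotonicity from an
  unknown lift to the explicit one.\<close>

lemma circle_lifts_differ_by_constant:
  fixes \<phi> \<psi> :: "real \<Rightarrow> real"
  assumes "continuous_on UNIV \<phi>" "continuous_on UNIV \<psi>" and eq: "\<And>t. cis (\<phi> t) = cis (\<psi> t)"
  obtains c where "\<And>t. \<phi> t = \<psi> t + c"
proof -
  have "(\<lambda>t. \<phi> t - \<psi> t) constant_on UNIV"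
  proof (rule continuous_discrete_range_constant)
    show "continuous_on UNIV (\<lambda>t. \<phi> t - \<psi> t)"
      using assms by (intro continuous_intros)
    have per: "\<exists>m::int. \<phi> t - \<psi> t = of_int m * (2 * pi)" for t
      using eq[of t] by (simp flip: cis_eq_1_iff cis_divide)
    have "2 * pi \<le> norm (\<phi> y - \<psi> y - (\<phi> x - \<psi> x))" if "\<phi> y - \<psi> y \<noteq> \<phi> x - \<psi> x" for x y
    proof -
      obtain k m :: int where "\<phi> y - \<psi> y = of_int k * (2 * pi)" "\<phi> x - \<psi> x = of_int m * (2 * pi)"
        using per by metis
      then have *: "\<phi> y - \<psi> y - (\<phi> x - \<psi> x) = of_int (k - m) * (2 * pi)" and "k \<noteq> m"
        using that by (auto simp: algebra_simps)
      then have "1 \<le> \<bar>real_of_int (k - m)\<bar>" by linarith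
      then show ?thesis unfolding * by (simp add: abs_mult)
    qed
    then show "\<exists>e>0. \<forall>y. y \<in> UNIV \<and> \<phi> y - \<psi> y \<noteq> \<phi> x - \<psi> x
        \<longrightarrow> e \<le> norm (\<phi> y - \<psi> y - (\<phi> x - \<psi> x))" for x
      by (intro exI[of _ "2 * pi"]) auto
  qed simp
  then obtain c where "\<And>t. \<phi> t - \<psi> t = c" by (auto simp: constant_on_def)
  then show thesis by (intro that[of c]) (simp add: algebra_simps)
qed

text \<open>A nondecreasing function with equal values at \<open>a\<close> and \<open>b\<close> is
  constant between them, so its derivative would vanish on the whole open interval. Zeros must be
  allowed because the derivative of the lift can vanish when the condition holds with
  equality.\<close>

lemma strict_mono_of_deriv_nonneg:
  fixes f :: "real \<Rightarrow> real"
  assumes der: "\<And>x. (f has_real_derivative f' x) (at x)" and nonneg: "\<And>x. 0 \<le> f' x"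
    and zeros: "\<And>a b. a < b \<Longrightarrow> \<exists>x\<in>{a<..<b}. f' x \<noteq> 0"
  shows "strict_mono f"
proof (rule strict_monoI)
  fix a b :: real assume "a < b"
  have mono: "f x \<le> f y" if "x \<le> y" for x y
    using that der nonneg by (metis DERIV_nonneg_imp_nondecreasing)
  show "f a < f b"
  proof (rule ccontr)
    assume "\<not> f a < f b"
    then have const: "f x = f a" if "a \<le> x" "x \<le> b" for x
      using mono[of a x] mono[of x b] that by linarith
    obtain x where x: "x \<in> {a<..<b}" "f' x \<noteq> 0" using zeros \<open>a < b\<close> by blast
    have "f' x = 0"
    proof (rule DERIV_local_const[OF der])
      show "0 < min (x - a) (b - x)" using x by auto
      show "\<forall>y. \<bar>x - y\<bar> < min (x - a) (b - x) \<longrightarrow> f x = f y"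
      proof (intro allI impI)
        fix y assume "\<bar>x - y\<bar> < min (x - a) (b - x)"
        then have "a \<le> x" "x \<le> b" "a \<le> y" "y \<le> b" by linarith+
        then show "f x = f y" using const[of x] const[of y] by simp
      qed
    qed
    with x show False by simp
  qed
qed

section \<open>The Poisson kernel\<close>

text \<open>For \<open>norm \<zeta> = 1\<close> the denominator equals
  \<open>(norm (\<zeta> - a))\<^sup>2\<close>, which gives the usual Poisson kernel; this form
  matches the denominator of a Blaschke factor.\<close>

definition poisson :: "complex \<Rightarrow> complex \<Rightarrow> real" where
  "poisson a \<zeta> = (1 - (norm a)\<^sup>2) / (norm (1 - cnj a * \<zeta>))\<^sup>2"

lemma poisson_zero [simp]: "poisson 0 \<zeta> = 1"
  by (simp add: poisson_def)

text \<open>Keeps the argument of \<open>Ln\<close> in the right half plane, away from the branch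
  cut.\<close>

lemma one_minus_cnj_mult_Re_pos:
  assumes "norm a < 1" "norm \<zeta> = 1"
  shows "0 < Re (1 - cnj a * \<zeta>)"
  using complex_Re_le_cmod[of "cnj a * \<zeta>"] assms by (simp add: norm_mult)

lemma one_minus_cnj_mult_nonzero:
  assumes "norm a < 1" "norm \<zeta> = 1"
  shows "1 - cnj a * \<zeta> \<noteq> 0"
  using one_minus_cnj_mult_Re_pos[OF assms] by (metis less_irrefl zero_complex.sel(1))

lemma norm_one_minus_sq: "(norm (1 - u))\<^sup>2 = 1 - 2 * Re u + (norm (u::complex))\<^sup>2"
  unfolding cmod_power2 by (simp add: power2_eq_square algebra_simps)

lemma poisson_radial_bound_eq:
  fixes r :: real
  assumes "r < 1"
  shows "(1 - r\<^sup>2) / (1 - r)\<^sup>2 = (1 + r) / (1 - r)"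
proof -
  have "1 - r\<^sup>2 = (1 + r) * (1 - r)" by (simp add: power2_eq_square algebra_simps)
  then show ?thesis using assms by (simp add: power2_eq_square)
qed

text \<open>The reverse triangle inequality bounds the denominator from below by
  \<open>(1 - norm a)\<^sup>2\<close>.\<close>

lemma poisson_le:
  assumes "norm a < 1" "norm \<zeta> = 1"
  shows "poisson a \<zeta> \<le> (1 + norm a) / (1 - norm a)"
proof -
  have "1 - norm a \<le> norm (1 - cnj a * \<zeta>)"
    using norm_triangle_ineq2[of 1 "cnj a * \<zeta>"] assms by (simp add: norm_mult)
  then have "poisson a \<zeta> \<le> (1 - (norm a)\<^sup>2) / (1 - norm a)\<^sup>2"
    unfolding poisson_def using assms
    by (intro divide_left_mono power_mono mult_pos_pos) (auto simp: power_le_one)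
  then show ?thesis using assms by (simp add: poisson_radial_bound_eq)
qed

lemma poisson_radial:
  assumes "norm a < 1" "norm \<zeta> = 1" "a = of_real (norm a) * \<zeta>"
  shows "poisson a \<zeta> = (1 + norm a) / (1 - norm a)"
proof -
  have "cnj a * \<zeta> = of_real (norm a) * (\<zeta> * cnj \<zeta>)"
    by (subst assms(3)) simp
  also have "\<dots> = of_real (norm a)"
    using assms(2) by (simp flip: complex_norm_square)
  finally have "norm (1 - cnj a * \<zeta>) = \<bar>1 - norm a\<bar>"
    by (metis norm_of_real of_real_1 of_real_diff)
  then show ?thesis using assms(1) by (simp add: poisson_def poisson_radial_bound_eq)
qed

text \<open>Equality of the kernels forces equality of the denominators. Expanding them gives
  \<open>Re u = norm u\<close> for \<open>u = cnj a * \<zeta>\<close>, so \<open>u\<close> is the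
  real number \<open>norm a\<close>; multiplying \<open>cnj u\<close> by \<open>\<zeta>\<close>
  recovers \<open>a\<close>.\<close>

lemma poisson_eq_bound_imp_radial:
  assumes "norm a < 1" "norm \<zeta> = 1" "poisson a \<zeta> = (1 + norm a) / (1 - norm a)"
  shows "a = of_real (norm a) * \<zeta>"
proof -
  define u where "u = cnj a * \<zeta>"
  have nu: "norm u = norm a" by (simp add: u_def norm_mult assms)
  have w: "norm (1 - u) \<noteq> 0"
    using one_minus_cnj_mult_nonzero[OF assms(1,2)] by (simp add: u_def)
  have "(1 - (norm a)\<^sup>2) \<noteq> 0"
    using assms(1) by (simp add: power2_eq_1_iff) (smt (verit) norm_ge_zero)
  moreover have "(1 - (norm a)\<^sup>2) / (norm (1 - u))\<^sup>2 = (1 - (norm a)\<^sup>2) / (1 - norm a)\<^sup>2"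
    using assms by (simp add: poisson_def poisson_radial_bound_eq u_def)
  ultimately have "(norm (1 - u))\<^sup>2 = (1 - norm a)\<^sup>2"
    using w assms(1) by (simp add: frac_eq_eq)
  moreover note norm_one_minus_sq[of u]
  ultimately have re: "Re u = norm u"
    by (simp add: nu power2_eq_square algebra_simps)
  then have "Im u = 0" using cmod_power2[of u] by simp
  then have "u = of_real (norm a)" using re nu by (simp add: complex_eq_iff)
  then have "cnj u * \<zeta> = of_real (norm a) * \<zeta>" by simp
  moreover have "cnj u * \<zeta> = a * (\<zeta> * cnj \<zeta>)" by (simp add: u_def)
  moreover have "\<zeta> * cnj \<zeta> = 1"
    using assms(2) by (simp flip: complex_norm_square)
  ultimately show ?thesis by simp
qed

section \<open>The lift\<close>

text \<open>Each \<open>Im (Ln _)\<close> is the principal argument of a point in the right half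
  plane when \<open>norm (z k) < 1\<close>, so it varies without jumps.\<close>

definition quotient_lift :: "complex \<Rightarrow> nat \<Rightarrow> (nat \<Rightarrow> complex) \<Rightarrow> real \<Rightarrow> real" where
  "quotient_lift \<sigma> n z t = t - Arg \<sigma> + 2 * (\<Sum>k=1..n. Im (Ln (1 - cnj (z k) * cis t)))"

lemma cis_two_Im_Ln:
  assumes "w \<noteq> 0"
  shows "cis (2 * Im (Ln w)) = w / cnj w"
proof -
  have "w / cnj w = exp (Ln w) / exp (cnj (Ln w))"
    using assms by (simp flip: exp_cnj)
  also have "\<dots> = exp (Ln w - cnj (Ln w))" by (simp add: exp_diff)
  also have "Ln w - cnj (Ln w) = \<i> * of_real (2 * Im (Ln w))"
    by (simp add: complex_eq_iff)
  finally show ?thesis by (simp add: cis_conv_exp)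
qed

lemma blaschke_factor_cis:
  assumes "norm a < 1"
  shows "(cis t - a) / (1 - cnj a * cis t) = cis (t - 2 * Im (Ln (1 - cnj a * cis t)))"
proof -
  define w where "w = 1 - cnj a * cis t"
  have w: "w \<noteq> 0" using one_minus_cnj_mult_nonzero[OF assms, of "cis t"] by (simp add: w_def)
  have "cis t * cnj w = cis t - a"
    by (simp add: w_def algebra_simps cis_cnj cis_mult)
  then have "(cis t - a) / w = cis t / (w / cnj w)" using w by simp
  also have "\<dots> = cis t / cis (2 * Im (Ln w))" by (simp only: cis_two_Im_Ln[OF w])
  finally show ?thesis unfolding w_def by (simp only: cis_divide)
qed

text \<open>The \<open>n\<close> Blaschke factors contribute \<open>n * t\<close> to the argument,
  which leaves a single \<open>t\<close> out of the \<open>n + 1\<close> in the numerator.\<close>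

lemma quotient_eq_cis_quotient_lift:
  assumes "\<forall>k\<in>{1..n}. norm (z k) < 1" "norm \<sigma> = 1"
  shows "cis t ^ (n + 1) / finite_blaschke \<sigma> n z (cis t) = cis (quotient_lift \<sigma> n z t)"
proof -
  have \<sigma>: "\<sigma> = cis (Arg \<sigma>)"
    using assms(2) cis_Arg[of \<sigma>] by (fastforce simp: sgn_div_norm)
  have "(\<Prod>k=1..n. (cis t - z k) / (1 - cnj (z k) * cis t))
      = (\<Prod>k=1..n. cis (t - 2 * Im (Ln (1 - cnj (z k) * cis t))))"
    using assms by (intro prod.cong refl blaschke_factor_cis) auto
  also have "\<dots> = cis (real n * t - 2 * (\<Sum>k=1..n. Im (Ln (1 - cnj (z k) * cis t))))"
    by (simp add: sum_subtractf sum_distrib_left flip: cis_sum)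
  finally have B: "finite_blaschke \<sigma> n z (cis t)
      = cis (Arg \<sigma> + (real n * t - 2 * (\<Sum>k=1..n. Im (Ln (1 - cnj (z k) * cis t)))))"
    unfolding finite_blaschke_def by (subst \<sigma>) (simp only: cis_mult)
  show ?thesis
    unfolding B Complex.DeMoivre cis_divide quotient_lift_def
    by (rule arg_cong[where f = cis]) (simp add: algebra_simps)
qed

text \<open>Logarithmic differentiation: \<open>w = 1 - u\<close> has derivative
  \<open>- (\<i> * u)\<close>, and both \<open>Im (- (\<i> * u) / w)\<close> and the Poisson kernel
  can be written through \<open>Re w / (norm w)\<^sup>2\<close>.\<close>

lemma has_real_derivative_Im_Ln:
  assumes "norm a < 1"
  shows "((\<lambda>t. 2 * Im (Ln (1 - cnj a * cis t))) has_real_derivative 1 - poisson a (cis t)) (at t)"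
proof -
  define u w where "u = cnj a * cis t" and "w = 1 - cnj a * cis t"
  have Re_w: "0 < Re w"
    using one_minus_cnj_mult_Re_pos[OF assms, of "cis t"] by (auto simp: w_def)
  then have w: "w \<notin> \<real>\<^sub>\<le>\<^sub>0" "w \<noteq> 0" by (auto simp: complex_nonpos_Reals_iff)
  have cis: "(cis has_vector_derivative \<i> * cis t) (at t)"
    using has_derivative_cis[OF has_derivative_ident] by (simp add: has_vector_derivative_def)
  have "((\<lambda>t. 1 - cnj a * cis t) has_vector_derivative - (\<i> * u)) (at t)"
    unfolding u_def by (auto intro!: derivative_eq_intros cis)
  moreover have "(Ln has_field_derivative inverse w) (at (1 - cnj a * cis t))"
    using has_field_derivative_Ln[OF w(1)] by (simp add: w_def)
  ultimately have "(Ln \<circ> (\<lambda>t. 1 - cnj a * cis t) has_vector_derivative - (\<i> * u) * inverse w) (at t)"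
    by (rule field_vector_diff_chain_at)
  then have "((\<lambda>t. Im (Ln (1 - cnj a * cis t))) has_vector_derivative Im (- (\<i> * u) * inverse w)) (at t)"
    unfolding o_def by (rule bounded_linear.has_vector_derivative[OF bounded_linear_Im])
  then have der: "((\<lambda>t. 2 * Im (Ln (1 - cnj a * cis t))) has_real_derivative
      2 * Im (- (\<i> * u) * inverse w)) (at t)"
    by (intro DERIV_cmult) (simp add: has_real_derivative_iff_has_vector_derivative)
  have uw: "u = 1 - w" and nu: "norm u = norm a" by (auto simp: u_def w_def norm_mult)
  have "Im (- (\<i> * u) * inverse w) = 1 - Re w / (norm w)\<^sup>2"
  proof -
    have "Im (- (\<i> * u) * inverse w) = - Re (u / w)" by (simp add: divide_inverse)
    also have "u / w = 1 / w - 1" using w by (simp add: uw field_simps)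
    also have "- Re (1 / w - 1) = 1 - Re w / (norm w)\<^sup>2"
      by (simp add: Re_divide cmod_power2)
    finally show ?thesis .
  qed
  \<comment> \<open>Since \<open>norm a = norm (1 - w)\<close>, the numerator of the kernel is
    \<open>2 * Re w - (norm w)\<^sup>2\<close>.\<close>
  moreover have "poisson a (cis t) = 2 * (Re w / (norm w)\<^sup>2) - 1"
  proof -
    have "(norm a)\<^sup>2 = 1 - 2 * Re w + (norm w)\<^sup>2"
      unfolding nu[symmetric] uw by (rule norm_one_minus_sq)
    then have "poisson a (cis t) = (2 * Re w - (norm w)\<^sup>2) / (norm w)\<^sup>2"
      by (simp add: poisson_def w_def)
    then show ?thesis using w by (simp add: diff_divide_distrib)
  qed
  ultimately have "2 * Im (- (\<i> * u) * inverse w) = 1 - poisson a (cis t)" by linarith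
  with der show ?thesis by metis
qed

lemma has_real_derivative_quotient_lift:
  assumes "\<forall>k\<in>{1..n}. norm (z k) < 1"
  shows "(quotient_lift \<sigma> n z has_real_derivative
           real n + 1 - (\<Sum>k=1..n. poisson (z k) (cis t))) (at t)"
proof -
  have "((\<lambda>t. t - Arg \<sigma> + (\<Sum>k=1..n. 2 * Im (Ln (1 - cnj (z k) * cis t)))) has_real_derivative
      1 - 0 + (\<Sum>k=1..n. 1 - poisson (z k) (cis t))) (at t)"
    using assms
    by (intro DERIV_add DERIV_diff DERIV_ident DERIV_const DERIV_sum has_real_derivative_Im_Ln) auto
  moreover have "1 - 0 + (\<Sum>k=1..n. 1 - poisson (z k) (cis t))
      = real n + 1 - (\<Sum>k=1..n. poisson (z k) (cis t))"
    by (simp add: sum_subtractf)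
  ultimately show ?thesis
    unfolding quotient_lift_def[abs_def] sum_distrib_left by (simp only:)
qed

lemma continuous_on_quotient_lift:
  assumes "\<forall>k\<in>{1..n}. norm (z k) < 1"
  shows "continuous_on UNIV (quotient_lift \<sigma> n z)"
  using has_real_derivative_quotient_lift[OF assms]
  by (meson DERIV_isCont continuous_at_imp_continuous_on)

text \<open>The logarithmic terms depend on \<open>t\<close> only through \<open>cis t\<close> and
  are therefore periodic; the leading \<open>t\<close> alone produces the shift.\<close>

lemma quotient_lift_shift: "quotient_lift \<sigma> n z (t + 2 * pi) = quotient_lift \<sigma> n z t + 2 * pi"
  by (simp add: quotient_lift_def flip: cis_mult)

lemma continuous_on_quotient:
  assumes "\<forall>k\<in>{1..n}. norm (z k) < 1" "norm \<sigma> = 1"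
  shows "continuous_on (sphere 0 1) (\<lambda>\<zeta>. \<zeta> ^ (n + 1) / finite_blaschke \<sigma> n z \<zeta>)"
proof -
  have nz: "1 - cnj (z k) * \<zeta> \<noteq> 0" if "k \<in> {1..n}" "norm \<zeta> = 1" for k \<zeta>
    using one_minus_cnj_mult_nonzero[of "z k" \<zeta>] assms that by blast
  have "\<zeta> \<noteq> z k" if "k \<in> {1..n}" "norm \<zeta> = 1" for k \<zeta>
    using assms that by fastforce
  then show ?thesis
    unfolding finite_blaschke_def
    using assms nz by (intro continuous_intros) auto
qed

section \<open>Sufficiency and necessity of the condition\<close>

lemma cis_not_constant_on_interval:
  assumes "a < b"
  shows "\<exists>t\<in>{a<..<b}. cis t \<noteq> c"
proof (rule ccontr)
  \<comment> \<open>A third of the length keeps \<open>a + d\<close> and \<open>a + 2 * d\<close>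
    inside the open interval; the cap \<open>1 < pi\<close> ensures
    \<open>sin d > 0\<close>.\<close>
  define d where "d = min 1 ((b - a) / 3)"
  have d: "0 < d" "d \<le> 1" "a + 2 * d < b" using assms by (auto simp: d_def min_def field_simps)
  assume "\<not> ?thesis"
  then have c: "cis t = c" if "a < t" "t < b" for t using that by auto
  have "cis (a + d) = c" "cis (a + 2 * d) = c" using d by (auto intro!: c)
  then have "cis ((a + 2 * d) - (a + d)) = 1"
    by (simp only: cis_divide[symmetric]) auto
  then have "sin d = 0" by (simp add: complex_eq_iff)
  moreover have "0 < sin d" using d pi_gt3 by (intro sin_gt_zero) auto
  ultimately show False by simp
qed

lemma quotient_circle_homeomorphism:
  assumes z: "\<forall>k\<in>{1..n}. norm (z k) < 1" and \<sigma>: "norm \<sigma> = 1"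
    and le: "(\<Sum>k=1..n. (1 + norm (z k)) / (1 - norm (z k))) \<le> real n + 1"
  shows "circle_homeomorphism (\<lambda>\<zeta>. \<zeta> ^ (n + 1) / finite_blaschke \<sigma> n z \<zeta>)"
proof (rule circle_homeomorphism_of_lift[where \<phi> = "quotient_lift \<sigma> n z"])
  let ?P = "\<lambda>t. \<Sum>k=1..n. poisson (z k) (cis t)"
  let ?b = "\<lambda>k. (1 + norm (z k)) / (1 - norm (z k))"
  have P_le: "?P t \<le> (\<Sum>k=1..n. ?b k)" for t
    using z by (intro sum_mono poisson_le) auto
  show "strict_mono (quotient_lift \<sigma> n z)"
  proof (rule strict_mono_of_deriv_nonneg)
    show "(quotient_lift \<sigma> n z has_real_derivative real n + 1 - ?P t) (at t)" for t
      using z by (rule has_real_derivative_quotient_lift)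
    show "0 \<le> real n + 1 - ?P t" for t using P_le[of t] le by linarith
    fix a b :: real assume "a < b"
    show "\<exists>t\<in>{a<..<b}. real n + 1 - ?P t \<noteq> 0"
    \<comment> \<open>If every \<open>z k\<close> is zero, the derivative is constantly 1. Otherwise
      a nonzero \<open>z k\<close> gives a strict inequality wherever \<open>cis t\<close> is not
      its direction, and every interval contains such a \<open>t\<close>.\<close>
    proof (cases "\<forall>k\<in>{1..n}. z k = 0")
      case True
      then have "?P t = real n" for t by simp
      then show ?thesis using dense[OF \<open>a < b\<close>] by auto
    next
      case False
      then obtain k where k: "k \<in> {1..n}" "z k \<noteq> 0" by auto
      obtain t where t: "t \<in> {a<..<b}" "cis t \<noteq> z k / of_real (norm (z k))"
        using cis_not_constant_on_interval[OF \<open>a < b\<close>] by blast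
      have "poisson (z k) (cis t) \<noteq> ?b k"
        using poisson_eq_bound_imp_radial[of "z k" "cis t"] z k t
        by (metis nonzero_mult_div_cancel_left norm_cis norm_eq_zero of_real_eq_0_iff)
      then have "poisson (z k) (cis t) < ?b k"
        using poisson_le[of "z k" "cis t"] z k by force
      then have "?P t < (\<Sum>k=1..n. ?b k)"
        using z k by (intro sum_strict_mono_ex1) (auto intro: poisson_le)
      then show ?thesis using t le by force
    qed
  qed
qed (simp_all only: quotient_lift_shift quotient_eq_cis_quotient_lift[OF z \<sigma>]
       continuous_on_quotient[OF z \<sigma>] continuous_on_quotient_lift[OF z])

text \<open>An increasing lift differs from the explicit one by a constant, so the latter increases
  as well; a Poisson sum above \<open>n + 1\<close> would make its derivative negative at
  \<open>t\<close> and the lift smaller just to the right of \<open>t\<close>.\<close>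

lemma quotient_sense_preserving_imp_poisson_le:
  assumes z: "\<forall>k\<in>{1..n}. norm (z k) < 1" and \<sigma>: "norm \<sigma> = 1"
    and "sense_preserving_on_circle (\<lambda>\<zeta>. \<zeta> ^ (n + 1) / finite_blaschke \<sigma> n z \<zeta>)"
  shows "(\<Sum>k=1..n. poisson (z k) (cis t)) \<le> real n + 1"
proof (rule ccontr)
  assume neg: "\<not> ?thesis"
  obtain \<phi> where \<phi>: "continuous_on UNIV \<phi>" "strict_mono \<phi>"
      "\<And>t. cis t ^ (n + 1) / finite_blaschke \<sigma> n z (cis t) = cis (\<phi> t)"
    using assms(3) unfolding sense_preserving_on_circle_def by blast
  have "cis (quotient_lift \<sigma> n z t) = cis (\<phi> t)" for t
    using \<phi>(3)[of t] quotient_eq_cis_quotient_lift[OF z \<sigma>, of t] by metis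
  then obtain c where c: "\<And>t. quotient_lift \<sigma> n z t = \<phi> t + c"
    using circle_lifts_differ_by_constant[OF continuous_on_quotient_lift[OF z] \<phi>(1)] by blast
  have "real n + 1 - (\<Sum>k=1..n. poisson (z k) (cis t)) < 0" using neg by linarith
  then obtain d where "d > 0" and
    d: "\<forall>h>0. h < d \<longrightarrow> quotient_lift \<sigma> n z (t + h) < quotient_lift \<sigma> n z t"
    using DERIV_neg_dec_right[OF has_real_derivative_quotient_lift[OF z]] by blast
  have "quotient_lift \<sigma> n z (t + d / 2) < quotient_lift \<sigma> n z t"
    using d \<open>d > 0\<close> by simp
  moreover have "\<phi> t < \<phi> (t + d / 2)"
    using strict_monoD[OF \<phi>(2)] \<open>d > 0\<close> by simp
  ultimately show False unfolding c by linarith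
qed

theorem theorem5p3:
  fixes n :: nat and z :: "nat \<Rightarrow> complex" and \<sigma> :: complex and B :: "complex \<Rightarrow> complex"
  assumes "n \<ge> 1"
    and "\<forall>k\<in>{1..n}. z k \<in> ball 0 1"
    and "\<sigma> \<in> sphere 0 1"
    and "B = finite_blaschke \<sigma> n z"
  shows "((\<Sum>k=1..n. (1 + norm (z k)) / (1 - norm (z k))) \<le> real n + 1
            \<longrightarrow> circle_homeomorphism (\<lambda>\<zeta>. \<zeta> ^ (n + 1) / B \<zeta>))
       \<and> ((\<forall>k\<in>{1..n}. norm (z k) \<le> 1 / (2 * real n + 1))
            \<longrightarrow> circle_homeomorphism (\<lambda>\<zeta>. \<zeta> ^ (n + 1) / B \<zeta>))
       \<and> ((\<exists>\<omega>\<in>sphere 0 1. \<forall>k\<in>{1..n}. z k = of_real (norm (z k)) * \<omega>)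
            \<longrightarrow> circle_homeomorphism (\<lambda>\<zeta>. \<zeta> ^ (n + 1) / B \<zeta>)
            \<longrightarrow> (\<Sum>k=1..n. (1 + norm (z k)) / (1 - norm (z k))) \<le> real n + 1)"
proof (intro conjI impI)
  have z: "\<forall>k\<in>{1..n}. norm (z k) < 1" and \<sigma>: "norm \<sigma> = 1"
    using assms by auto
  note homeo = quotient_circle_homeomorphism[OF z \<sigma>, folded assms(4)]
  show "circle_homeomorphism (\<lambda>\<zeta>. \<zeta> ^ (n + 1) / B \<zeta>)"
    if "(\<Sum>k=1..n. (1 + norm (z k)) / (1 - norm (z k))) \<le> real n + 1"
    using homeo that .
  show "circle_homeomorphism (\<lambda>\<zeta>. \<zeta> ^ (n + 1) / B \<zeta>)"
    if small: "\<forall>k\<in>{1..n}. norm (z k) \<le> 1 / (2 * real n + 1)"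
  proof (rule homeo)
    \<comment> \<open>The radius \<open>1 / (2 * n + 1)\<close> is the point where
      \<open>(1 + r) / (1 - r)\<close> equals \<open>(n + 1) / n\<close>, so \<open>n\<close> such
      terms add up to at most \<open>n + 1\<close>.\<close>
    have "(1 + norm (z k)) / (1 - norm (z k)) \<le> (real n + 1) / real n" if "k \<in> {1..n}" for k
    proof -
      have "norm (z k) * (2 * real n + 1) \<le> 1"
        using small that by (simp add: pos_le_divide_eq)
      then have "(1 + norm (z k)) * real n \<le> (real n + 1) * (1 - norm (z k))"
        by (simp add: algebra_simps)
      then show ?thesis
        using z that assms(1) by (simp add: pos_divide_le_eq pos_le_divide_eq)
    qed
    then have "(\<Sum>k=1..n. (1 + norm (z k)) / (1 - norm (z k))) \<le> (\<Sum>k=1..n. (real n + 1) / real n)"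
      by (intro sum_mono)
    also have "\<dots> = real n + 1" using assms(1) by simp
    finally show "(\<Sum>k=1..n. (1 + norm (z k)) / (1 - norm (z k))) \<le> real n + 1" .
  qed
  assume "\<exists>\<omega>\<in>sphere 0 1. \<forall>k\<in>{1..n}. z k = of_real (norm (z k)) * \<omega>"
  then obtain \<omega> where \<omega>: "norm \<omega> = 1" "\<forall>k\<in>{1..n}. z k = of_real (norm (z k)) * \<omega>" by auto
  assume "circle_homeomorphism (\<lambda>\<zeta>. \<zeta> ^ (n + 1) / B \<zeta>)"
  \<comment> \<open>The Poisson sum is evaluated in the common direction \<open>\<omega>\<close>,
    where all the individual bounds are attained at once.\<close>
  then have "(\<Sum>k=1..n. poisson (z k) (cis (Arg \<omega>))) \<le> real n + 1"
    unfolding circle_homeomorphism_def assms(4)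
    by (intro quotient_sense_preserving_imp_poisson_le[OF z \<sigma>]) blast
  moreover have "cis (Arg \<omega>) = \<omega>"
    using \<omega>(1) cis_Arg[of \<omega>] by (fastforce simp: sgn_div_norm)
  moreover have "(\<Sum>k=1..n. poisson (z k) \<omega>) = (\<Sum>k=1..n. (1 + norm (z k)) / (1 - norm (z k)))"
    using z \<omega> by (intro sum.cong refl poisson_radial) auto
  ultimately show "(\<Sum>k=1..n. (1 + norm (z k)) / (1 - norm (z k))) \<le> real n + 1" by simp
qed

end
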